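(* Let $J=[0,T]$, $f:J\times\mathbb{R}^n\to\mathbb{R}^n$, $x_0\in\mathbb{R}^n$, and let $x:J\to\mathbb{R}^n$ be the solution of $\dot x=f(t,x)$, $x(0)=x_0$. Suppose $f(t,x)$ is a locally Lipschitz function of $x$ and a continuous function of $t$ for all $(t,x)\in J\times\mathcal{D}'$, where $\mathcal{D}'\subset\mathbb{R}^n$ is an open set that contains $x(t)$ for all $t\in J$. Let $\{\hat x^j\}_{j\ge 0}$ be the sequence of approximate solutions on $J$ generated by the SIRM method with subspaces $S^j$ and orthogonal projections $P^j$ onto $S^j$ ($j\ge1$). Assume that for each iteration $j\ge 1$: (i) $x_0\in S^j$; (ii) the initial state of the reduced model is $\hat x^j_0=P^jx_0$; (iii) $P^jf(t,\hat x^{j-1}(t))=f(t,\hat x^{j-1}(t))$ for all $t\in J$. Then the sequence $\{\hat x^j(t)\}$ uniformly converges to $x(t)$ for all $t\in J$.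
   Context: SIRM (subspace iteration using reduced models): start from a test function $\hat x^0:J\to\mathbb{R}^n$ as trial solution. At iteration $j\ge1$, a linear subspace $S^j\subset\mathbb{R}^n$ is built from $\hat x^{j-1}$ (in the algorithm, from samples of the states $\hat x^{j-1}(t)$ and of the tangent vectors $f(t,\hat x^{j-1}(t))$; for the present statement the only assumptions on $S^j$ are those listed in the claim). With $P^j$ the orthogonal projection matrix onto $S^j$, the next approximation $\hat x^j$ is the solution of the Galerkin reduced model $\dot{\hat x}^j=P^jf(t,\hat x^j)$, $\hat x^j(0)=\hat x^j_0$. Standing assumption: the solution $x(t)$ and the reduced solutions $\hat x^j(t)$ exist on all of $J$. "Locally Lipschitz function of $x$" on $J\times\mathcal{D}'$ means every point of $J\times\mathcal{D}'$ has a neighborhood in $J\times\mathcal{D}'$ on which $f$ is Lipschitz in $x$ with a constant independent of $t$. *)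

theory Defs
  imports "HOL-Analysis.Analysis"
begin

text \<open>At the endpoints of \<open>{0..T}\<close> the derivative is one-sided.\<close>

definition solves_ivp ::
  "(real \<Rightarrow> 'a::real_normed_vector \<Rightarrow> 'a) \<Rightarrow> real \<Rightarrow> 'a \<Rightarrow> (real \<Rightarrow> 'a) \<Rightarrow> bool"
where
  "solves_ivp f T x\<^sub>0 x \<longleftrightarrow>
     x 0 = x\<^sub>0 \<and>
     (\<forall>t\<in>{0..T}. (x has_vector_derivative f t (x t)) (at t within {0..T}))"

definition orth_proj_matrix :: "real^'n^'n \<Rightarrow> (real^'n) set \<Rightarrow> bool" where
  "orth_proj_matrix P S \<longleftrightarrow> subspace S \<and> (\<forall>v. P *v v \<in> S \<and> v - P *v v \<in> S\<^sup>\<bottom>)"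

text \<open>
  The entry \<open>xh 0\<close> is the trial solution, an arbitrary function. The rule by which the
  algorithm builds \<open>S j\<close> from \<open>xh (j - 1)\<close> is left unspecified: \<open>S j\<close> is any subspace, and so
  far \<open>xi j\<close>, the initial state of the \<open>j\<close>-th reduced model, is any vector. The values
  \<open>S 0\<close>, \<open>P 0\<close> and \<open>xi 0\<close> are irrelevant.
\<close>

definition sirm_sequence ::
  "(real \<Rightarrow> real^'n \<Rightarrow> real^'n) \<Rightarrow> real \<Rightarrow> (nat \<Rightarrow> (real^'n) set) \<Rightarrow> (nat \<Rightarrow> real^'n^'n) \<Rightarrow>
   (nat \<Rightarrow> real^'n) \<Rightarrow> (nat \<Rightarrow> real \<Rightarrow> real^'n) \<Rightarrow> bool"
where
  "sirm_sequence f T S P xi xh \<longleftrightarrow>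
     (\<forall>j\<ge>1. orth_proj_matrix (P j) (S j) \<and>
             solves_ivp (\<lambda>t y. P j *v f t y) T (xi j) (xh j))"

end

theory Submission
  imports Defs
begin

text \<open>
  Let \<open>e\<^sub>j = x\<^sup>j - x\<close> be the error of the \<open>j\<close>-th iterate. Since \<open>P\<^sup>j\<close> fixes \<open>f(t, x\<^sup>j\<^sup>-\<^sup>1)\<close>,
  \<open>e\<^sub>j' = P\<^sup>j (f(t, x\<^sup>j) - f(t, x)) + (I - P\<^sup>j) (f(t, x\<^sup>j\<^sup>-\<^sup>1) - f(t, x))\<close>,
  so \<open>\<bar>e\<^sub>j'\<bar> \<le> L (\<bar>e\<^sub>j\<bar> + \<bar>e\<^sub>j\<^sub>-\<^sub>1\<bar>)\<close> as long as both iterates stay in a compact tube around \<open>x\<close> on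
  which \<open>f\<close> is bounded and uniformly Lipschitz. Nothing is known outside the tube, where in
  particular the trial solution may lie, but an iterate with \<open>j \<ge> 1\<close> moves away from \<open>x\<close> with
  bounded speed inside it. Hence there is a step \<open>h\<close>, independent of \<open>j\<close>, such that uniform
  convergence on \<open>[0, a]\<close> keeps almost all iterates in the tube up to time \<open>a + h\<close>, and for small
  \<open>h\<close> the estimate on \<open>e\<^sub>j'\<close> then contracts the errors on \<open>[0, a + h]\<close>. Finitely many steps cover
  \<open>[0, T]\<close>.
\<close>

section \<open>Orthogonal projection matrices\<close>

lemma orth_proj_matrix_fixes:
  assumes "orth_proj_matrix P S" "v \<in> S"
  shows "P *v v = v"
proof -
  have "v - P *v v \<in> S" "v - P *v v \<in> S\<^sup>\<bottom>"
    using assms by (auto simp: orth_proj_matrix_def intro: subspace_diff)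
  then have "orthogonal (v - P *v v) (v - P *v v)"
    by (auto simp: orthogonal_comp_def)
  then show ?thesis by (simp add: orthogonal_self)
qed

lemma orth_proj_matrix_pythagoras:
  assumes "orth_proj_matrix P S"
  shows "(norm v)\<^sup>2 = (norm (P *v v))\<^sup>2 + (norm (v - P *v v))\<^sup>2"
proof -
  have "orthogonal (P *v v) (v - P *v v)"
    using assms by (auto simp: orth_proj_matrix_def orthogonal_comp_def)
  then show ?thesis using norm_add_Pythagorean by fastforce
qed

text \<open>Both halves of the Pythagorean identity are needed: the error derivative splits into a
  \<open>P\<close> part and an \<open>I - P\<close> part, and each is to be bounded with constant
  1.\<close>

lemma orth_proj_matrix_norm_le:
  assumes "orth_proj_matrix P S"
  shows "norm (P *v v) \<le> norm v" "norm (v - P *v v) \<le> norm v"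
  using orth_proj_matrix_pythagoras[OF assms, of v] by (auto intro: power2_le_imp_le)

section \<open>Uniform constants on a tube around the solution\<close>

text \<open>Constants exist near each time, since \<open>x\<close> is continuous and
  \<open>D\<close> is open; compactness of \<open>{0..T}\<close>, in the form of bisection, makes
  them global. Separate continuity in \<open>t\<close> suffices for \<open>M\<close>: it controls
  \<open>f\<close> at a fixed centre, and the Lipschitz bound does the rest.\<close>

lemma lipschitz_tube:
  fixes f :: "real \<Rightarrow> 'a::real_normed_vector \<Rightarrow> 'a" and x :: "real \<Rightarrow> 'a"
  assumes T: "0 \<le> T" and x: "continuous_on {0..T} x"
    and D: "open D" "\<And>t. t \<in> {0..T} \<Longrightarrow> x t \<in> D"
    and lip: "local_lipschitz {0..T} D f"
    and cont: "\<And>y. y \<in> D \<Longrightarrow> continuous_on {0..T} (\<lambda>t. f t y)"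
  obtains r L M where "0 < r"
    "\<And>t. t \<in> {0..T} \<Longrightarrow> L-lipschitz_on (cball (x t) r) (f t)"
    "\<And>t y. t \<in> {0..T} \<Longrightarrow> y \<in> cball (x t) r \<Longrightarrow> norm (f t y) \<le> M"
proof -
  \<comment> \<open>The intersection with \<open>{0..T}\<close> is there because the bisection
    principle also tests short intervals that stick out of \<open>{0..T}\<close>.\<close>
  define good where "good I \<longleftrightarrow> (\<exists>r>0. \<exists>L M. \<forall>t\<in>I \<inter> {0..T}.
      L-lipschitz_on (cball (x t) r) (f t) \<and> (\<forall>y\<in>cball (x t) r. norm (f t y) \<le> M))"
    for I :: "real set"
  have good_Un: "good (A \<union> B)" if A: "good A" and B: "good B" for A B
  proof -
    obtain r L M where 1: "0 < r"
      "\<forall>t\<in>A \<inter> {0..T}. L-lipschitz_on (cball (x t) r) (f t) \<and> (\<forall>y\<in>cball (x t) r. norm (f t y) \<le> M)"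
      using A unfolding good_def by blast
    obtain r' L' M' where 2: "0 < r'"
      "\<forall>t\<in>B \<inter> {0..T}. L'-lipschitz_on (cball (x t) r') (f t) \<and> (\<forall>y\<in>cball (x t) r'. norm (f t y) \<le> M')"
      using B unfolding good_def by blast
    have *: "(max L L')-lipschitz_on (cball (x t) (min r r')) (f t)
        \<and> (\<forall>y\<in>cball (x t) (min r r'). norm (f t y) \<le> max M M')"
      if "t \<in> (A \<union> B) \<inter> {0..T}" for t
    proof (cases "t \<in> A")
      case True
      then have "L-lipschitz_on (cball (x t) r) (f t)" "\<forall>y\<in>cball (x t) r. norm (f t y) \<le> M"
        using 1(2) that by auto
      then show ?thesis by (fastforce intro: lipschitz_on_mono simp: le_max_iff_disj)
    next
      case False
      then have "L'-lipschitz_on (cball (x t) r') (f t)" "\<forall>y\<in>cball (x t) r'. norm (f t y) \<le> M'"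
        using 2(2) that by auto
      then show ?thesis by (fastforce intro: lipschitz_on_mono simp: le_max_iff_disj)
    qed
    show ?thesis
      unfolding good_def using 1(1) 2(1) *
      by (intro exI[of _ "min r r'"] conjI exI[of _ "max L L'"] exI[of _ "max M M'"]) auto
  qed
  have "good {0..T}"
  proof (rule Bolzano[OF T, where P = "\<lambda>a b. good {a..b}"])
    fix a b c :: real
    assume "good {a..b}" "good {b..c}" "a \<le> b" "b \<le> c"
    then show "good {a..c}" using good_Un[of "{a..b}" "{b..c}"] by (simp add: ivl_disj_un)
  next
    fix s assume "0 \<le> s" "s \<le> T"
    then have s: "s \<in> {0..T}" by simp
    obtain u L where u: "0 < u"
      "\<And>t. t \<in> cball s u \<inter> {0..T} \<Longrightarrow> L-lipschitz_on (cball (x s) u \<inter> D) (f t)"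
      using local_lipschitzE[OF lip s D(2)[OF s]] by metis
    obtain v where v: "0 < v" "cball (x s) v \<subseteq> D"
      using D s open_contains_cball by blast
    define w where "w = min u v"
    have w: "0 < w" "w \<le> u" "cball (x s) w \<subseteq> cball (x s) u \<inter> D"
      using u(1) v by (auto simp: w_def)
    obtain d1 where d1: "0 < d1" "\<And>t. t \<in> {0..T} \<Longrightarrow> dist t s < d1 \<Longrightarrow> dist (x t) (x s) < w / 2"
      using x[unfolded continuous_on_iff, rule_format, OF s, of "w / 2"] w(1) by auto
    obtain d2 where d2: "0 < d2"
      "\<And>t. t \<in> {0..T} \<Longrightarrow> dist t s < d2 \<Longrightarrow> dist (f t (x s)) (f s (x s)) < 1"
      using cont[OF D(2)[OF s], unfolded continuous_on_iff, rule_format, OF s, of 1] by auto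
    have L: "0 \<le> L" using u(2)[of s] s u(1) lipschitz_on_nonneg by fastforce
    show "\<exists>d>0. \<forall>a b. a \<le> s \<and> s \<le> b \<and> b - a < d \<longrightarrow> good {a..b}"
    \<comment> \<open>Over such a short interval \<open>x\<close> moves by less than
      \<open>w / 2\<close>, so a ball of radius \<open>w / 2\<close> around \<open>x t\<close> stays
      in the ball of radius \<open>w\<close> around \<open>x s\<close>; \<open>f\<close> at
      \<open>x s\<close> changes by less than 1; and the Lipschitz constant \<open>L\<close> is
      valid throughout.\<close>
    proof (intro exI[of _ "Min {d1, d2, u}"] conjI allI impI)
      show "0 < Min {d1, d2, u}" using d1 d2 u by simp
      fix a b :: real assume ab: "a \<le> s \<and> s \<le> b \<and> b - a < Min {d1, d2, u}"
      have "L-lipschitz_on (cball (x t) (w / 2)) (f t)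
          \<and> (\<forall>y\<in>cball (x t) (w / 2). norm (f t y) \<le> norm (f s (x s)) + 1 + L * w)"
        if "t \<in> {a..b} \<inter> {0..T}" for t
      proof -
        have t: "t \<in> {0..T}" "dist t s < d1" "dist t s < d2" "dist s t < u"
          using that ab by (auto simp: dist_real_def)
        have lw: "L-lipschitz_on (cball (x s) w) (f t)"
          using u(2)[of t] t w(3) by (auto intro: lipschitz_on_subset)
        have sub: "cball (x t) (w / 2) \<subseteq> cball (x s) w"
        proof
          fix y assume "y \<in> cball (x t) (w / 2)"
          then show "y \<in> cball (x s) w"
            using d1(2)[OF t(1,2)] dist_triangle[of "x s" y "x t"] by (simp add: dist_commute)
        qed
        have "norm (f t y) \<le> norm (f s (x s)) + 1 + L * w" if "y \<in> cball (x t) (w / 2)" for y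
        proof -
          have y: "y \<in> cball (x s) w" using sub that by auto
          have "norm (f t y - f t (x s)) \<le> L * norm (y - x s)"
            using lipschitz_on_normD[OF lw y] w(1) by auto
          also have "\<dots> \<le> L * w"
            using y L by (intro mult_left_mono) (auto simp: dist_norm norm_minus_commute)
          finally have "norm (f t y - f t (x s)) \<le> L * w" .
          moreover have "norm (f t (x s) - f s (x s)) < 1"
            using d2(2)[OF t(1,3)] by (simp add: dist_norm)
          ultimately show ?thesis
            using norm_triangle_sub[of "f t y" "f t (x s)"]
              norm_triangle_sub[of "f t (x s)" "f s (x s)"] by linarith
        qed
        then show ?thesis using lipschitz_on_subset[OF lw sub] by auto
      qed
      then show "good {a..b}"
        unfolding good_def using w(1)
        by (intro exI[of _ "w / 2"] conjI exI[of _ L] exI[of _ "norm (f s (x s)) + 1 + L * w"] ballI) auto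
    qed
  qed
  then obtain r L M where "0 < r" "\<forall>t\<in>{0..T}. L-lipschitz_on (cball (x t) r) (f t)
      \<and> (\<forall>y\<in>cball (x t) r. norm (f t y) \<le> M)"
    unfolding good_def Int_absorb by blast
  then show thesis using that by blast
qed

section \<open>Growth estimates from bounds on the derivative\<close>

text \<open>Mean value inequality. The bound on \<open>g\<close> is asked only strictly between
  \<open>a\<close> and \<open>b\<close>, so it can be applied up to a first exit time.\<close>

lemma norm_increment_le:
  fixes e g :: "real \<Rightarrow> 'a::real_normed_vector"
  assumes der: "\<And>t. t \<in> {0..T} \<Longrightarrow> (e has_vector_derivative g t) (at t within {0..T})"
    and ab: "0 \<le> a" "a \<le> b" "b \<le> T"
    and B: "\<And>t. a < t \<Longrightarrow> t < b \<Longrightarrow> norm (g t) \<le> B"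
  shows "norm (e b - e a) \<le> B * (b - a)"
proof (cases "a = b")
  case False
  then have "a < b" using ab by simp
  have "continuous_on {0..T} e"
    unfolding continuous_on_eq_continuous_within
    by (blast intro: has_vector_derivative_continuous der)
  then have c: "continuous_on {a..b} e"
    by (rule continuous_on_subset) (use ab in auto)
  have "norm (e b - e a) \<le> B * b - B * a"
  proof (rule differentiable_bound_general[OF \<open>a < b\<close> c, where \<phi>' = "\<lambda>_. B"])
    show "continuous_on {a..b} ((*) B)" by (intro continuous_intros)
    show "((*) B has_vector_derivative B) (at t)" for t
      by (auto intro!: derivative_eq_intros simp: has_real_derivative_iff_has_vector_derivative[symmetric])
    fix t assume t: "a < t" "t < b"
    then have "t \<in> interior {0..T}" using ab by auto
    then show "(e has_vector_derivative g t) (at t)"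
      using der[of t] at_within_interior[of t "{0..T}"] interior_subset by (metis subsetD)
    show "norm (g t) \<le> B" using B t by simp
  qed
  then show ?thesis by (simp add: algebra_simps)
qed simp

text \<open>At a first exit time \<open>s\<close> the curve would have travelled from
  \<open>e a\<close> to norm \<open>r\<close> with speed at most \<open>B\<close>, which
  \<open>start\<close> rules out.\<close>

lemma norm_stays_below:
  fixes e g :: "real \<Rightarrow> 'a::real_normed_vector"
  assumes der: "\<And>t. t \<in> {0..T} \<Longrightarrow> (e has_vector_derivative g t) (at t within {0..T})"
    and ab: "0 \<le> a" "b \<le> T"
    and B: "\<And>t. t \<in> {0..T} \<Longrightarrow> norm (e t) \<le> r \<Longrightarrow> norm (g t) \<le> B"
    and start: "norm (e a) + B * (b - a) < r" and "0 \<le> B"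
    and t: "a \<le> t" "t \<le> b"
  shows "norm (e t) < r"
proof (rule ccontr)
  assume "\<not> norm (e t) < r"
  define Z where "Z = {s \<in> {a..b}. r \<le> norm (e s)}"
  have "continuous_on {0..T} e"
    unfolding continuous_on_eq_continuous_within
    by (blast intro: has_vector_derivative_continuous der)
  then have c: "continuous_on {a..b} e"
    by (rule continuous_on_subset) (use ab in auto)
  have "closed Z"
    unfolding Z_def by (intro continuous_on_closed_Collect_le continuous_intros c)
  moreover have "Z = Z \<inter> {a..b}" by (auto simp: Z_def)
  ultimately have "compact Z" by (metis closed_Int_compact compact_Icc)
  moreover have "t \<in> Z" using \<open>\<not> norm (e t) < r\<close> t by (simp add: Z_def)
  ultimately obtain s where s: "s \<in> Z" "\<And>z. z \<in> Z \<Longrightarrow> s \<le> z"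
    using compact_attains_inf[of Z] by blast
  have s': "a \<le> s" "s \<le> b" "r \<le> norm (e s)" using s(1) by (auto simp: Z_def)
  have "norm (g u) \<le> B" if "a < u" "u < s" for u
    using s(2)[of u] that s' ab by (intro B) (force simp: Z_def)+
  then have "norm (e s - e a) \<le> B * (s - a)"
    using s' ab by (intro norm_increment_le[OF der]) auto
  also have "\<dots> \<le> B * (b - a)" using s' \<open>0 \<le> B\<close> by (intro mult_left_mono) auto
  finally have "norm (e s - e a) \<le> B * (b - a)" .
  then show False using start s'(3) norm_triangle_sub[of "e s" "e a"] by linarith
qed

section \<open>Convergence of the error recursion\<close>

lemma error_recursion_tendsto_0:
  fixes e g :: "nat \<Rightarrow> real \<Rightarrow> 'a::real_normed_vector"
  assumes T: "0 \<le> T"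
    and der: "\<And>j t. t \<in> {0..T} \<Longrightarrow> (e j has_vector_derivative g j t) (at t within {0..T})"
    and init: "\<And>j. e j 0 = 0" and r: "0 < r" and B0: "0 \<le> B" and L0: "0 \<le> L"
    and B: "\<And>j t. t \<in> {0..T} \<Longrightarrow> norm (e j t) \<le> r \<Longrightarrow> norm (g j t) \<le> B"
    and L: "\<And>j t. t \<in> {0..T} \<Longrightarrow> norm (e j t) \<le> r \<Longrightarrow> norm (e (Suc j) t) \<le> r \<Longrightarrow>
      norm (g (Suc j) t) \<le> L * (norm (e j t) + norm (e (Suc j) t))"
  shows "uniform_limit {0..T} e (\<lambda>_. 0) sequentially"
proof -
  \<comment> \<open>The first bound gives \<open>L * h \<le> 1 / 4\<close>, for the contraction; the
    second gives \<open>B * h < r / 2\<close>, for confinement to the tube. Adding 1 avoids division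
    by zero.\<close>
  define h where "h = min (1 / (4 * (L + 1))) (r / (2 * (B + 1)))"
  have h: "0 < h" using r B0 L0 by (auto simp: h_def)
  have "L * h \<le> L * (1 / (4 * (L + 1)))" using L0 by (intro mult_left_mono) (auto simp: h_def)
  also have "\<dots> \<le> 1 / 4" using L0 by (simp add: field_simps)
  finally have Lh: "L * h \<le> 1 / 4" .
  have "B * h \<le> B * (r / (2 * (B + 1)))" using B0 by (intro mult_left_mono) (auto simp: h_def)
  also have "\<dots> < r / 2" using B0 r by (simp add: field_simps)
  finally have Bh: "B * h < r / 2" .
  have step: "uniform_limit {0..b} e (\<lambda>_. 0) sequentially"
    if lim: "uniform_limit {0..a} e (\<lambda>_. 0) sequentially"
      and ab: "0 \<le> a" "a \<le> b" "b \<le> T" "b - a \<le> h" for a b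
  proof -
    have small: "\<forall>\<^sub>F j in sequentially. \<forall>t\<in>{0..a}. norm (e j t) < \<epsilon>" if "0 < \<epsilon>" for \<epsilon>
      using uniform_limitD[OF lim that] by simp
    \<comment> \<open>Case \<open>m = 0\<close> is confinement to the tube; each further
      \<open>m\<close> gains a factor \<open>3 / 4\<close>, at the price of discarding more
      iterates.\<close>
    have geom: "\<forall>\<^sub>F j in sequentially. \<forall>t\<in>{0..b}. norm (e j t) \<le> (3 / 4) ^ m * r" for m
    proof (induction m)
      case 0
      show ?case
        using small[OF half_gt_zero[OF r]]
      proof (rule eventually_mono)
        fix j assume elim: "\<forall>t\<in>{0..a}. norm (e j t) < r / 2"
        have "norm (e j t) < r" if "t \<in> {0..b}" for t
        proof (cases "t \<le> a")
          case True
          then show ?thesis using elim that r by force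
        next
          case False
          \<comment> \<open>Half of \<open>r\<close> covers the error at \<open>a\<close>, the other
            half the distance travelled after \<open>a\<close>.\<close>
          have "B * (b - a) \<le> B * h" using ab B0 by (intro mult_left_mono) auto
          moreover have "norm (e j a) < r / 2" using elim ab by auto
          ultimately have "norm (e j a) + B * (b - a) < r" using Bh by linarith
          then show ?thesis
            using norm_stays_below[OF der ab(1,3) B] B0 False that by auto
        qed
        then show "\<forall>t\<in>{0..b}. norm (e j t) \<le> (3 / 4) ^ 0 * r" by (simp add: less_imp_le)
      qed
    next
      case (Suc m)
      define \<rho> where "\<rho> = (3 / 4) ^ m * r"
      have \<rho>: "0 < \<rho>" "\<rho> \<le> r"
        using r by (auto simp: \<rho>_def mult_le_cancel_right1 power_le_one)
      \<comment> \<open>The new bound is \<open>\<rho> / 4\<close> inherited at time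
        \<open>a\<close>, plus at most \<open>L * (2 * \<rho>) * h \<le> \<rho> / 2\<close> of
        growth after it.\<close>
      obtain N where N: "\<And>j t. N \<le> j \<Longrightarrow> t \<in> {0..b} \<Longrightarrow> norm (e j t) \<le> \<rho>"
        "\<And>j t. N \<le> j \<Longrightarrow> t \<in> {0..a} \<Longrightarrow> norm (e j t) < \<rho> / 4"
        using eventually_conj[OF Suc.IH small[of "\<rho> / 4"]] \<rho>
        unfolding eventually_sequentially \<rho>_def[symmetric] by (metis zero_less_divide_iff zero_less_numeral)
      have "norm (e (Suc i) t) \<le> 3 / 4 * \<rho>" if i: "N \<le> i" and t: "t \<in> {0..b}" for i t
      proof (cases "t \<le> a")
        case True
        then show ?thesis using N(2)[of "Suc i" t] i t \<rho> by simp
      next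
        case False
        have "norm (g (Suc i) u) \<le> L * (2 * \<rho>)" if "a < u" "u < t" for u
        proof -
          have u: "u \<in> {0..T}" "u \<in> {0..b}" using that t ab by auto
          have n: "norm (e i u) \<le> \<rho>" "norm (e (Suc i) u) \<le> \<rho>" using N(1) i u by auto
          then have "norm (g (Suc i) u) \<le> L * (norm (e i u) + norm (e (Suc i) u))"
            using L[OF u(1)] \<rho> by force
          also have "\<dots> \<le> L * (2 * \<rho>)" using n L0 by (intro mult_left_mono) auto
          finally show ?thesis .
        qed
        then have "norm (e (Suc i) t - e (Suc i) a) \<le> L * (2 * \<rho>) * (t - a)"
          using False t ab by (intro norm_increment_le[OF der]) auto
        also have "\<dots> \<le> L * (2 * \<rho>) * h" using t ab \<rho> L0 by (intro mult_left_mono) auto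
        also have "\<dots> = (L * h) * (2 * \<rho>)" by simp
        also have "\<dots> \<le> 1 / 4 * (2 * \<rho>)" using Lh \<rho> by (intro mult_right_mono) auto
        finally have "norm (e (Suc i) t - e (Suc i) a) \<le> \<rho> / 2" by simp
        moreover have "norm (e (Suc i) a) < \<rho> / 4" using N(2) i ab by auto
        ultimately show ?thesis
          using norm_triangle_sub[of "e (Suc i) t" "e (Suc i) a"] by linarith
      qed
      then have "\<forall>i\<ge>N. \<forall>t\<in>{0..b}. norm (e (Suc i) t) \<le> (3 / 4) ^ Suc m * r"
        by (simp add: \<rho>_def mult.assoc)
      then show ?case
        by (subst eventually_sequentially_Suc[symmetric]) (auto simp: eventually_sequentially)
    qed
    show ?thesis
    proof (rule uniform_limitI)
      fix \<epsilon> :: real assume \<epsilon>: "0 < \<epsilon>"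
      obtain m where "(3 / 4) ^ m < \<epsilon> / r"
        using real_arch_pow_inv[of "\<epsilon> / r" "3 / 4"] \<epsilon> r by auto
      then have "(3 / 4) ^ m * r < \<epsilon>" using r by (simp add: field_simps)
      then show "\<forall>\<^sub>F j in sequentially. \<forall>t\<in>{0..b}. dist (e j t) 0 < \<epsilon>"
        using geom[of m] by (auto elim!: eventually_mono)
    qed
  qed
  \<comment> \<open>For \<open>k = 0\<close> the interval is a single point, where all errors
    vanish.\<close>
  have "uniform_limit {0..min T (real k * h)} e (\<lambda>_. 0) sequentially" for k
  proof (induction k)
    case 0
    then show ?case using T init by (auto intro!: uniform_limitI)
  next
    case (Suc k)
    show ?case
      by (rule step[OF Suc.IH]) (use T h in \<open>auto simp: algebra_simps min_def\<close>)
  qed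
  moreover obtain k where "T \<le> real k * h"
    using reals_Archimedean3[OF h] less_imp_le by blast
  ultimately show ?thesis by (metis min.absorb1)
qed

section \<open>Application to the SIRM iterates\<close>

theorem theorem3p3:
  fixes T :: real
    and f :: "real \<Rightarrow> real^'n \<Rightarrow> real^'n"
    and x\<^sub>0 :: "real^'n"
    and x :: "real \<Rightarrow> real^'n"
    and D :: "(real^'n) set"
    and S :: "nat \<Rightarrow> (real^'n) set"
    and P :: "nat \<Rightarrow> real^'n^'n"
    and xi :: "nat \<Rightarrow> real^'n"
    and xh :: "nat \<Rightarrow> real \<Rightarrow> real^'n"
  assumes "0 \<le> T"
    and "solves_ivp f T x\<^sub>0 x"
    and "open D"
    and "\<And>t. t \<in> {0..T} \<Longrightarrow> x t \<in> D"
    and "local_lipschitz {0..T} D f"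
    and "\<And>y. y \<in> D \<Longrightarrow> continuous_on {0..T} (\<lambda>t. f t y)"
    and "sirm_sequence f T S P xi xh"
    and "\<And>j. j \<ge> 1 \<Longrightarrow> x\<^sub>0 \<in> S j"
    and "\<And>j. j \<ge> 1 \<Longrightarrow> xi j = P j *v x\<^sub>0"
    and "\<And>j t. j \<ge> 1 \<Longrightarrow> t \<in> {0..T} \<Longrightarrow> P j *v f t (xh (j - 1) t) = f t (xh (j - 1) t)"
  shows "uniform_limit {0..T} xh x sequentially"
proof -
  have x: "x 0 = x\<^sub>0"
    "\<And>t. t \<in> {0..T} \<Longrightarrow> (x has_vector_derivative f t (x t)) (at t within {0..T})"
    using assms(2) by (auto simp: solves_ivp_def)
  have P: "orth_proj_matrix (P j) (S j)" if "1 \<le> j" for j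
    using assms(7) that by (auto simp: sirm_sequence_def)
  have xh: "xh j 0 = x\<^sub>0"
    "\<And>t. t \<in> {0..T} \<Longrightarrow> (xh j has_vector_derivative P j *v f t (xh j t)) (at t within {0..T})"
    if "1 \<le> j" for j
    using assms(7) that orth_proj_matrix_fixes[OF P[OF that] assms(8)[OF that]] assms(9)[OF that]
    by (auto simp: sirm_sequence_def solves_ivp_def)
  have "continuous_on {0..T} x"
    unfolding continuous_on_eq_continuous_within
    by (blast intro: has_vector_derivative_continuous x(2))
  then obtain r L M where r: "0 < r"
    and lip: "\<And>t. t \<in> {0..T} \<Longrightarrow> L-lipschitz_on (cball (x t) r) (f t)"
    and M: "\<And>t y. t \<in> {0..T} \<Longrightarrow> y \<in> cball (x t) r \<Longrightarrow> norm (f t y) \<le> M"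
    using lipschitz_tube[of T x D f, OF assms(1) _ assms(3-6)] by blast
  have 0: "0 \<in> {0..T}" using assms(1) by simp
  have L0: "0 \<le> L" using lip[OF 0] by (rule lipschitz_on_nonneg)
  have M0: "0 \<le> M"
    using M[OF 0, of "x 0"] r norm_ge_zero[of "f 0 (x 0)"] by (simp del: norm_ge_zero)
  \<comment> \<open>The shift leaves out the trial solution \<open>xh 0\<close>, which need neither
    start at \<open>x\<^sub>0\<close> nor be differentiable.\<close>
  define e where "e j t = xh (Suc j) t - x t" for j t
  define g where "g j t = P (Suc j) *v f t (xh (Suc j) t) - f t (x t)" for j t
  have tube: "xh (Suc j) t \<in> cball (x t) r" "x t \<in> cball (x t) r" if "norm (e j t) \<le> r" for j t
    using that r by (auto simp: e_def dist_norm norm_minus_commute)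
  have fdiff: "norm (f t (xh (Suc j) t) - f t (x t)) \<le> L * norm (e j t)"
    if "t \<in> {0..T}" "norm (e j t) \<le> r" for j t
    using lipschitz_on_normD[OF lip[OF that(1)] tube[OF that(2)]] by (simp add: e_def)
  have "uniform_limit {0..T} e (\<lambda>_. 0) sequentially"
  proof (rule error_recursion_tendsto_0[OF assms(1), where g = g and r = r and B = "2 * M" and L = L])
    show "(e j has_vector_derivative g j t) (at t within {0..T})" if "t \<in> {0..T}" for j t
      unfolding e_def g_def using that by (intro has_vector_derivative_diff xh x) auto
    show "e j 0 = 0" for j by (simp add: e_def xh x)
    show "norm (g j t) \<le> 2 * M" if t: "t \<in> {0..T}" "norm (e j t) \<le> r" for j t
    proof -
      have "norm (P (Suc j) *v f t (xh (Suc j) t)) \<le> norm (f t (xh (Suc j) t))"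
        using P by (intro orth_proj_matrix_norm_le) auto
      then show ?thesis
        unfolding g_def using M[OF t(1) tube(1)[OF t(2)]] M[OF t(1) tube(2)[OF t(2)]]
          norm_triangle_ineq4[of "P (Suc j) *v f t (xh (Suc j) t)" "f t (x t)"] by linarith
    qed
    show "norm (g (Suc j) t) \<le> L * (norm (e j t) + norm (e (Suc j) t))"
      if t: "t \<in> {0..T}" "norm (e j t) \<le> r" "norm (e (Suc j) t) \<le> r" for j t
    proof -
      define Q where "Q = P (Suc (Suc j))"
      define u where "u = f t (xh (Suc (Suc j)) t) - f t (x t)"
      define v where "v = f t (xh (Suc j) t) - f t (x t)"
      have Q: "orth_proj_matrix Q (S (Suc (Suc j)))" using P by (simp add: Q_def)
      have "Q *v f t (xh (Suc j) t) = f t (xh (Suc j) t)"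
        using assms(10)[of "Suc (Suc j)" t] t by (simp add: Q_def)
      \<comment> \<open>Since \<open>Q\<close> fixes the field along the previous iterate,
        \<open>I - Q\<close> maps \<open>f t (x t)\<close> to minus its value at
        \<open>v\<close>.\<close>
      then have "g (Suc j) t = Q *v u + (v - Q *v v)"
        by (simp add: g_def Q_def u_def v_def matrix_vector_mult_diff_distrib)
      then have "norm (g (Suc j) t) \<le> norm u + norm v"
        using norm_triangle_ineq[of "Q *v u" "v - Q *v v"] orth_proj_matrix_norm_le[OF Q]
        by (metis add_mono order_trans)
      then show ?thesis
        using fdiff[OF t(1,2)] fdiff[OF t(1,3)] by (simp add: u_def v_def algebra_simps)
    qed
  qed (use r L0 M0 in auto)
  then have "uniform_limit {0..T} (\<lambda>j. xh (Suc j)) x sequentially"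
    unfolding uniform_limit_iff e_def by (simp add: dist_norm)
  then show ?thesis
    unfolding uniform_limit_iff
    using eventually_sequentially_Suc[of "\<lambda>j. \<forall>t\<in>{0..T}. dist (xh j t) (x t) < _"] by blast
qed

end
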